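(* Let $(u_n)_{n\ge 1}$ be the sequence defined by $u_1 = u_2 = u_3 = 1$ and $u_n = u_{n-1} + u_{n-2} + u_{n-3}$ for $n \ge 4$, and let $S_n = u_1 + u_2 + \cdots + u_n$. Then for every integer $n \ge 5$, $$S_n = 2S_{n-1} - S_{n-4}.$$
   Context: The sequence $(u_n)$ is called the sequence of pseudo-Fibonacci numbers of order 3. *)

theory Defs
  imports Main
begin

text \<open>
  Pseudo-Fibonacci numbers of order 3. The sequence starts at index 1; the value at 0 is a dummy,
  used neither by the recurrence nor by the partial sums.
\<close>

fun pseudo_fib3 :: "nat \<Rightarrow> int" where
  "pseudo_fib3 0 = 0"
| "pseudo_fib3 (Suc 0) = 1"
| "pseudo_fib3 (Suc (Suc 0)) = 1"
| "pseudo_fib3 (Suc (Suc (Suc 0))) = 1"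
| "pseudo_fib3 (Suc (Suc (Suc (Suc n)))) =
     pseudo_fib3 (Suc (Suc (Suc n))) + pseudo_fib3 (Suc (Suc n)) + pseudo_fib3 (Suc n)"

lemma pseudo_fib3_initial:
  "pseudo_fib3 1 = 1" "pseudo_fib3 2 = 1" "pseudo_fib3 3 = 1"
  by (simp_all add: numeral_eq_Suc)

lemma pseudo_fib3_rec:
  assumes "n \<ge> 4"
  shows "pseudo_fib3 n = pseudo_fib3 (n - 1) + pseudo_fib3 (n - 2) + pseudo_fib3 (n - 3)"
proof -
  from assms have "n = Suc (Suc (Suc (Suc (n - 4))))" by simp
  then obtain m where "n = Suc (Suc (Suc (Suc m)))" ..
  then show ?thesis by (simp add: numeral_eq_Suc)
qed

definition pseudo_fib3_sum :: "nat \<Rightarrow> int" where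
  "pseudo_fib3_sum n = (\<Sum>k = 1..n. pseudo_fib3 k)"

end

theory Submission
  imports Defs
begin

text \<open>The recurrence makes each new term a block of three consecutive terms, hence a
  difference of partial sums: S_n - S_{n-1} = u_n = u_{n-1} + u_{n-2} + u_{n-3} = S_{n-1} -
  S_{n-4}.\<close>

lemma pseudo_fib3_sum_Suc:
  "pseudo_fib3_sum (Suc n) = pseudo_fib3_sum n + pseudo_fib3 (Suc n)"
  by (simp add: pseudo_fib3_sum_def)

theorem mainTheorem18:
  fixes n :: nat
  assumes "n \<ge> 5"
  shows "pseudo_fib3_sum n = 2 * pseudo_fib3_sum (n - 1) - pseudo_fib3_sum (n - 4)"
proof -
  obtain m where "n = Suc (Suc (Suc (Suc m)))"
    using assms by (intro that[of "n - 4"]) simp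
  then show ?thesis
    \<comment> \<open>Peeling terms off down to S_m and expanding u_{m+4} by the recurrence turns
      both sides into S_m + 2 (u_{m+1} + u_{m+2} + u_{m+3}).\<close>
    by (simp add: pseudo_fib3_sum_Suc numeral_eq_Suc)
qed

end
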